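(* Let $\tau$ be a nonzero cardinal number and let $A$ be a nonempty conjugate invariant subset of $\mathbb{C}$ (i.e. $\overline{\lambda}\in A$ for each $\lambda\in A$). Let $\mathcal{S}$ be the additive semigroup generated by $$\{\sigma_{\phi,u}\restriction_{\ell^2(\tau)}:\phi\in\tau^\tau,\ u\in(A\cup\{0\})^\tau,\ \sigma_{\phi,u}(\ell^2(\tau))\subseteq\ell^2(\tau)\},$$ i.e. the additive semigroup generated by the $A\cup\{0\}$-weighted generalized shift operators on $\ell^2(\tau)$. Then the following statements are equivalent: 1. $\mathcal{S}$ is adjoint invariant, i.e. $T^*\in\mathcal{S}$ for each $T\in\mathcal{S}$; 2. $\tau$ is finite or $0$ is not a limit point of $A$.
   Context: For a nonzero cardinal number $\tau$ (regarded as a set), $\ell^2(\tau)=\{x\in\mathbb{C}^\tau: \sum_{\alpha\in\tau}|x_\alpha|^2<\infty\}$ is the complex Hilbert space with inner product $\langle x,y\rangle=\sum_{\alpha\in\tau}x_\alpha\overline{y_\alpha}$. For a self-map $\phi:\tau\to\tau$ and a weight vector $u=(u_\alpha)_{\alpha\in\tau}\in\mathbb{C}^\tau$, the weighted generalized shift is the linear map $\sigma_{\phi,u}:\mathbb{C}^\tau\to\mathbb{C}^\tau$, $(x_\alpha)_{\alpha\in\tau}\mapsto(u_\alpha x_{\phi(\alpha)})_{\alpha\in\tau}$; it is called a $B$-weighted generalized shift if $u_\alpha\in B$ for every $\alpha\in\tau$. It is known that if $\sigma_{\phi,u}(\ell^2(\tau))\subseteq\ell^2(\tau)$ then $\sigma_{\phi,u}\restriction_{\ell^2(\tau)}:\ell^2(\tau)\to\ell^2(\tau)$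 is automatically a bounded operator, and that this inclusion holds if and only if $\sup\{(\sum_{\alpha\in\phi^{-1}(\beta)}|u_\alpha|^2)^{1/2}:\beta\in\phi(\tau)\}<+\infty$. $\tau^\tau$ is the set of all self-maps of $\tau$. $T^*$ denotes the Hilbert space adjoint of a bounded operator $T$. The additive semigroup generated by a set of operators is the set of all finite nonempty sums of elements of that set. A limit point of $A$ is an accumulation point: $0$ is a limit point of $A$ if every neighbourhood of $0$ in $\mathbb{C}$ contains a point of $A\setminus\{0\}$. *)

theory Defs
  imports "HOL-Analysis.Analysis"
begin

text \<open>
  A nonzero cardinal \<open>\<tau>\<close> is represented by a type \<open>'a\<close> (HOL types are nonempty), so that
  \<open>\<complex>\<^sup>\<tau>\<close> is the type \<open>'a \<Rightarrow> complex\<close>. The type variable is universally quantified in theorems.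
\<close>

definition ell2 :: "('a \<Rightarrow> complex) set" where
  "ell2 = {x. (\<lambda>\<alpha>. (cmod (x \<alpha>))\<^sup>2) summable_on UNIV}"

definition ell2_inner :: "('a \<Rightarrow> complex) \<Rightarrow> ('a \<Rightarrow> complex) \<Rightarrow> complex" where
  "ell2_inner x y = (\<Sum>\<^sub>\<infinity>\<alpha>. x \<alpha> * cnj (y \<alpha>))"

text \<open>
  Operators on \<open>\<ell>\<^sup>2(\<tau>)\<close> are elements of \<open>ell2 \<rightarrow>\<^sub>E ell2\<close>: maps of \<open>ell2\<close> into itself that are
  \<open>undefined\<close> off \<open>ell2\<close>, so that equality of HOL functions is equality of operators.
\<close>

type_synonym 'a ell2_op = "('a \<Rightarrow> complex) \<Rightarrow> ('a \<Rightarrow> complex)"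

definition ell2_op_add :: "'a ell2_op \<Rightarrow> 'a ell2_op \<Rightarrow> 'a ell2_op" where
  "ell2_op_add S T = (\<lambda>x\<in>ell2. \<lambda>\<alpha>. S x \<alpha> + T x \<alpha>)"

definition is_ell2_adjoint :: "'a ell2_op \<Rightarrow> 'a ell2_op \<Rightarrow> bool" where
  "is_ell2_adjoint T T' \<longleftrightarrow> T' \<in> ell2 \<rightarrow>\<^sub>E ell2 \<and>
     (\<forall>x\<in>ell2. \<forall>y\<in>ell2. ell2_inner (T x) y = ell2_inner x (T' y))"

text \<open>
  Meaningful for bounded linear operators \<open>T\<close>, for which the adjoint exists by the Riesz
  representation theorem; uniqueness holds for every \<open>T\<close> and is shown below.
\<close>

definition ell2_adjoint :: "'a ell2_op \<Rightarrow> 'a ell2_op" where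
  "ell2_adjoint T = (THE T'. is_ell2_adjoint T T')"

definition wgs :: "('a \<Rightarrow> 'a) \<Rightarrow> ('a \<Rightarrow> complex) \<Rightarrow> ('a \<Rightarrow> complex) \<Rightarrow> ('a \<Rightarrow> complex)" where
  "wgs \<phi> u x = (\<lambda>\<alpha>. u \<alpha> * x (\<phi> \<alpha>))"

definition wgs_operators :: "complex set \<Rightarrow> 'a ell2_op set" where
  "wgs_operators B =
     {restrict (wgs \<phi> u) ell2 | \<phi> u. (\<forall>\<alpha>. u \<alpha> \<in> B) \<and> wgs \<phi> u ` ell2 \<subseteq> ell2}"

inductive_set additive_semigroup :: "'a ell2_op set \<Rightarrow> 'a ell2_op set"
  for G :: "'a ell2_op set" where
  generator: "T \<in> G \<Longrightarrow> T \<in> additive_semigroup G"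
| add: "S \<in> additive_semigroup G \<Longrightarrow> T \<in> additive_semigroup G \<Longrightarrow>
        ell2_op_add S T \<in> additive_semigroup G"

definition adjoint_invariant :: "'a ell2_op set \<Rightarrow> bool" where
  "adjoint_invariant \<S> \<longleftrightarrow> (\<forall>T\<in>\<S>. ell2_adjoint T \<in> \<S>)"

definition conjugate_invariant :: "complex set \<Rightarrow> bool" where
  "conjugate_invariant A \<longleftrightarrow> (\<forall>z\<in>A. cnj z \<in> A)"

lemma is_ell2_adjoint_unique:
  assumes "is_ell2_adjoint T T'" and "is_ell2_adjoint T T''"
  shows "T' = T''"
proof (rule extensionalityI[of _ ell2])
  show "T' \<in> extensional ell2" "T'' \<in> extensional ell2"
    using assms by (auto simp: is_ell2_adjoint_def PiE_def)
  fix y :: "'a \<Rightarrow> complex" assume y: "y \<in> ell2"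
  show "T' y = T'' y"
  proof
    fix \<alpha> :: 'a
    let ?e = "\<lambda>\<beta>. if \<beta> = \<alpha> then 1 else 0 :: complex"
    have "(\<lambda>\<beta>. (cmod (?e \<beta>))\<^sup>2) summable_on {\<alpha>}"
      by simp
    then have e: "?e \<in> ell2"
      unfolding ell2_def mem_Collect_eq
      by (rule summable_on_cong_neutral[THEN iffD1, rotated -1]) auto
    have inner_e: "ell2_inner ?e z = cnj (z \<alpha>)" for z
    proof -
      have "ell2_inner ?e z = (\<Sum>\<^sub>\<infinity>\<beta>\<in>{\<alpha>}. ?e \<beta> * cnj (z \<beta>))"
        unfolding ell2_inner_def by (rule infsum_cong_neutral) auto
      then show ?thesis by simp
    qed
    have "ell2_inner ?e (T' y) = ell2_inner ?e (T'' y)"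
      using assms e y unfolding is_ell2_adjoint_def by metis
    then show "T' y \<alpha> = T'' y \<alpha>"
      by (simp add: inner_e)
  qed
qed

lemma ell2_adjoint_eqI: "is_ell2_adjoint T T' \<Longrightarrow> ell2_adjoint T = T'"
  unfolding ell2_adjoint_def by (blast intro: the_equality is_ell2_adjoint_unique)

end

theory Submission
  imports Defs
begin

text \<open>
  In matrix terms, \<open>\<sigma>\<^bsub>\<phi>,u\<^esub>\<close> has at most one nonzero entry in each row, so members of the semigroup
  have finitely many nonzero entries in each row. The adjoint of \<open>\<sigma>\<^bsub>\<phi>,u\<^esub>\<close> has the entries
  \<open>cnj (u \<alpha>)\<close>, for \<open>\<alpha>\<close> in the fibre of \<open>\<phi>\<close> over \<open>\<beta>\<close>, in row \<open>\<beta>\<close>. Boundedness makes the square sums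
  of \<open>u\<close> over the fibres bounded; if \<open>\<tau>\<close> is finite or the nonzero weights stay away from \<open>0\<close>, each
  fibre thus contains at most \<open>N\<close> nonzero weights, and picking the \<open>k\<close>-th one in every fibre, for
  \<open>k \<le> N\<close>, writes the adjoint as a sum of \<open>N + 1\<close> shifts. Otherwise there is a square summable \<open>u\<close> with
  infinite support and values in \<open>A \<union> {0}\<close>; with \<open>\<phi>\<close> constant, the adjoint has a row of infinite
  support.
\<close>

section \<open>Sums and inner products of square summable families\<close>

lemma ell2_single: "(\<lambda>\<beta>. if \<beta> = \<alpha> then c else 0) \<in> ell2"
proof -
  have "(\<lambda>\<beta>. (cmod (if \<beta> = \<alpha> then c else 0))\<^sup>2) summable_on {\<alpha>}"
    by simp
  then show ?thesis
    unfolding ell2_def mem_Collect_eq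
    by (rule summable_on_cong_neutral[THEN iffD1, rotated -1]) auto
qed

lemma ell2_add:
  assumes "x \<in> ell2" "y \<in> ell2"
  shows "(\<lambda>\<alpha>. x \<alpha> + y \<alpha>) \<in> ell2"
proof -
  have "(\<lambda>\<alpha>. 2 * (cmod (x \<alpha>))\<^sup>2 + 2 * (cmod (y \<alpha>))\<^sup>2) summable_on UNIV"
    using assms unfolding ell2_def by (auto intro!: summable_on_add summable_on_cmult_right)
  moreover have "(cmod (x \<alpha> + y \<alpha>))\<^sup>2 \<le> 2 * (cmod (x \<alpha>))\<^sup>2 + 2 * (cmod (y \<alpha>))\<^sup>2" for \<alpha>
  proof -
    have "(cmod (x \<alpha> + y \<alpha>))\<^sup>2 \<le> (cmod (x \<alpha>) + cmod (y \<alpha>))\<^sup>2"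
      by (simp add: norm_triangle_ineq power_mono)
    also have "\<dots> \<le> 2 * (cmod (x \<alpha>))\<^sup>2 + 2 * (cmod (y \<alpha>))\<^sup>2"
      using sum_squares_bound[of "cmod (x \<alpha>)" "cmod (y \<alpha>)"] by (simp add: power2_sum)
    finally show ?thesis .
  qed
  ultimately show ?thesis
    unfolding ell2_def mem_Collect_eq by (rule summable_on_comparison_test) auto
qed

lemma ell2_inner_summable:
  assumes "x \<in> ell2" "y \<in> ell2"
  shows "(\<lambda>\<alpha>. x \<alpha> * cnj (y \<alpha>)) summable_on UNIV"
proof -
  have "(\<lambda>\<alpha>. (cmod (x \<alpha>))\<^sup>2 + (cmod (y \<alpha>))\<^sup>2) summable_on UNIV"
    using assms unfolding ell2_def by (auto intro!: summable_on_add)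
  moreover have "norm (x \<alpha> * cnj (y \<alpha>)) \<le> (cmod (x \<alpha>))\<^sup>2 + (cmod (y \<alpha>))\<^sup>2" for \<alpha>
  proof -
    have "2 * norm (x \<alpha> * cnj (y \<alpha>)) \<le> (cmod (x \<alpha>))\<^sup>2 + (cmod (y \<alpha>))\<^sup>2"
      using sum_squares_bound[of "cmod (x \<alpha>)" "cmod (y \<alpha>)"] by (simp add: norm_mult)
    then show ?thesis
      using norm_ge_zero[of "x \<alpha> * cnj (y \<alpha>)"] by linarith
  qed
  ultimately have "(\<lambda>\<alpha>. norm (x \<alpha> * cnj (y \<alpha>))) summable_on UNIV"
    by (rule summable_on_comparison_test) auto
  then show ?thesis
    by (rule abs_summable_summable)
qed

lemma ell2_inner_add_left:
  assumes "x \<in> ell2" "y \<in> ell2" "z \<in> ell2"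
  shows "ell2_inner (\<lambda>\<alpha>. x \<alpha> + y \<alpha>) z = ell2_inner x z + ell2_inner y z"
  using assms by (simp add: ell2_inner_def distrib_right infsum_add ell2_inner_summable)

lemma ell2_inner_add_right:
  assumes "x \<in> ell2" "y \<in> ell2" "z \<in> ell2"
  shows "ell2_inner x (\<lambda>\<alpha>. y \<alpha> + z \<alpha>) = ell2_inner x y + ell2_inner x z"
  using assms by (simp add: ell2_inner_def distrib_left infsum_add ell2_inner_summable)

text \<open>Reduces closure under adjoints to the generators. That \<open>S\<close> and
  \<open>T\<close> map into \<open>ell2\<close> makes the inner products summable, so that they may
  be split.\<close>

lemma is_ell2_adjoint_add:
  assumes "S \<in> ell2 \<rightarrow>\<^sub>E ell2" "T \<in> ell2 \<rightarrow>\<^sub>E ell2"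
    and S: "is_ell2_adjoint S S'" and T: "is_ell2_adjoint T T'"
  shows "is_ell2_adjoint (ell2_op_add S T) (ell2_op_add S' T')"
  unfolding is_ell2_adjoint_def
proof (intro conjI ballI)
  have S': "S' \<in> ell2 \<rightarrow>\<^sub>E ell2" and T': "T' \<in> ell2 \<rightarrow>\<^sub>E ell2"
    using S T by (auto simp: is_ell2_adjoint_def)
  then show "ell2_op_add S' T' \<in> ell2 \<rightarrow>\<^sub>E ell2"
    by (auto simp: ell2_op_add_def intro!: ell2_add)
  fix x y :: "'a \<Rightarrow> complex" assume x: "x \<in> ell2" and y: "y \<in> ell2"
  have "ell2_inner (ell2_op_add S T x) y = ell2_inner (S x) y + ell2_inner (T x) y"
    using ell2_inner_add_left[OF PiE_mem[OF assms(1) x] PiE_mem[OF assms(2) x] y] x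
    by (simp add: ell2_op_add_def)
  also have "\<dots> = ell2_inner x (S' y) + ell2_inner x (T' y)"
    using S T x y by (simp add: is_ell2_adjoint_def)
  also have "\<dots> = ell2_inner x (ell2_op_add S' T' y)"
    using ell2_inner_add_right[OF x PiE_mem[OF S' y] PiE_mem[OF T' y]] y
    by (simp add: ell2_op_add_def)
  finally show "ell2_inner (ell2_op_add S T x) y = ell2_inner x (ell2_op_add S' T' y)" .
qed

section \<open>The additive semigroup of the shifts\<close>

lemma additive_semigroup_maps_ell2:
  assumes "T \<in> additive_semigroup (wgs_operators B)"
  shows "T \<in> ell2 \<rightarrow>\<^sub>E ell2"
  using assms
  by induction (auto simp: wgs_operators_def ell2_op_add_def PiE_mem intro!: ell2_add)

text \<open>The range \<open>k \<le> N\<close> is never empty, as befits a semigroup that admits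
  only nonempty sums.\<close>

lemma additive_semigroup_sum:
  assumes "\<And>k. k \<le> (N::nat) \<Longrightarrow> restrict (f k) ell2 \<in> G"
  shows "restrict (\<lambda>x \<alpha>. \<Sum>k\<le>N. f k x \<alpha>) ell2 \<in> additive_semigroup G"
  using assms
proof (induction N)
  case 0
  then show ?case
    by (simp add: additive_semigroup.generator)
next
  case (Suc N)
  have "ell2_op_add (restrict (\<lambda>x \<alpha>. \<Sum>k\<le>N. f k x \<alpha>) ell2) (restrict (f (Suc N)) ell2)
          \<in> additive_semigroup G"
    by (intro additive_semigroup.add Suc.IH additive_semigroup.generator[of "restrict _ _"] Suc.prems)
      simp_all
  also have "ell2_op_add (restrict (\<lambda>x \<alpha>. \<Sum>k\<le>N. f k x \<alpha>) ell2) (restrict (f (Suc N)) ell2)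
          = restrict (\<lambda>x \<alpha>. \<Sum>k\<le>Suc N. f k x \<alpha>) ell2"
    by (auto simp: ell2_op_add_def fun_eq_iff restrict_def)
  finally show ?case .
qed

text \<open>Finiteness of the row \<open>\<beta>\<close>, expressed without matrices:
  \<open>F\<close> contains the columns of its nonzero entries. One column suffices for a generator,
  and sums take unions. This is the obstruction used for necessity.\<close>

lemma additive_semigroup_finite_row:
  assumes "T \<in> additive_semigroup (wgs_operators B)"
  shows "\<exists>F. finite F \<and> (\<forall>x\<in>ell2. (\<forall>\<alpha>\<in>F. x \<alpha> = 0) \<longrightarrow> T x \<beta> = 0)"
  using assms
proof induction
  case (generator T)
  then obtain \<phi> u where "T = restrict (wgs \<phi> u) ell2"
    by (auto simp: wgs_operators_def)
  then show ?case
    by (intro exI[of _ "{\<phi> \<beta>}"]) (auto simp: wgs_def)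
next
  case (add S T)
  then obtain F G where "finite F" "finite G"
    "\<forall>x\<in>ell2. (\<forall>\<alpha>\<in>F. x \<alpha> = 0) \<longrightarrow> S x \<beta> = 0" "\<forall>x\<in>ell2. (\<forall>\<alpha>\<in>G. x \<alpha> = 0) \<longrightarrow> T x \<beta> = 0"
    by blast
  then show ?case
    by (intro exI[of _ "F \<union> G"]) (auto simp: ell2_op_add_def)
qed

section \<open>Sums over the fibres of the index map\<close>

text \<open>The fibres partition the index set, so \<open>snd\<close> is a bijection from their
  disjoint union, where Fubini applies.\<close>

lemma infsum_fibres:
  fixes f :: "'a \<Rightarrow> 'b::banach" and \<phi> :: "'a \<Rightarrow> 'c"
  assumes "f summable_on UNIV"
  shows "(\<lambda>\<beta>. infsum f (\<phi> -` {\<beta>})) summable_on UNIV"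
    and "infsum f UNIV = (\<Sum>\<^sub>\<infinity>\<beta>. infsum f (\<phi> -` {\<beta>}))"
proof -
  let ?S = "Sigma UNIV (\<lambda>\<beta>. \<phi> -` {\<beta>})"
  have inj: "inj_on snd ?S" and im: "snd ` ?S = UNIV"
    by (auto simp: inj_on_def image_iff)
  have eq: "f \<circ> snd = (\<lambda>(\<beta>, \<alpha>). f \<alpha>)"
    by auto
  have s: "(\<lambda>(\<beta>, \<alpha>). f \<alpha>) summable_on ?S"
    using summable_on_reindex[OF inj, of f] assms unfolding im eq by simp
  show "(\<lambda>\<beta>. infsum f (\<phi> -` {\<beta>})) summable_on UNIV"
    using summable_on_Sigma_banach[OF s] by simp
  show "infsum f UNIV = (\<Sum>\<^sub>\<infinity>\<beta>. infsum f (\<phi> -` {\<beta>}))"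
    using infsum_Sigma'_banach[OF s] infsum_reindex[OF inj, of f] unfolding im eq by simp
qed

text \<open>The unit vector at \<open>\<beta>\<close> is mapped to \<open>u\<close> cut down to the
  fibre over \<open>\<beta>\<close>.\<close>

lemma wgs_fibre_summable:
  assumes "wgs \<phi> u ` ell2 \<subseteq> ell2"
  shows "(\<lambda>\<alpha>. (cmod (u \<alpha>))\<^sup>2) summable_on \<phi> -` {\<beta>}"
proof -
  have "wgs \<phi> u (\<lambda>\<gamma>. if \<gamma> = \<beta> then 1 else 0) \<in> ell2"
    by (rule subsetD[OF assms imageI[OF ell2_single]])
  then show ?thesis
    unfolding ell2_def mem_Collect_eq
    by (rule summable_on_cong_neutral[THEN iffD1, rotated -1]) (auto simp: wgs_def)
qed

text \<open>
  If the fibre sums were unbounded, one could choose \<open>b n\<close> with fibre sum above \<open>4 ^ n\<close>, and the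
  image of \<open>\<Sum>n. 2\<^sup>-\<^sup>n e\<^bsub>b n\<^esub>\<close> would have infinite norm.
\<close>

lemma wgs_fibre_bounded:
  assumes "wgs \<phi> u ` ell2 \<subseteq> ell2"
  obtains M where "\<And>\<beta>. (\<Sum>\<^sub>\<infinity>\<alpha>\<in>\<phi> -` {\<beta>}. (cmod (u \<alpha>))\<^sup>2) \<le> M"
proof (rule ccontr)
  define c where "c \<beta> = (\<Sum>\<^sub>\<infinity>\<alpha>\<in>\<phi> -` {\<beta>}. (cmod (u \<alpha>))\<^sup>2)" for \<beta>
  assume "\<not> thesis"
  with that have unb: "\<exists>\<beta>. M < c \<beta>" for M
    unfolding c_def by (meson not_le)
  \<comment> \<open>The strict increase of \<open>c (b n)\<close> is there to make \<open>b\<close>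
    injective.\<close>
  have "\<exists>b. \<forall>n. 4 ^ n < c (b n) \<and> c (b n) < c (b (Suc n))"
  proof (rule dependent_nat_choice)
    show "\<exists>\<beta>. 4 ^ 0 < c \<beta>"
      by (rule unb)
    show "\<exists>\<gamma>. 4 ^ Suc n < c \<gamma> \<and> c \<beta> < c \<gamma>" for \<beta> n
      using unb[of "max (4 ^ Suc n) (c \<beta>)"] by auto
  qed
  then obtain b :: "nat \<Rightarrow> _" where b: "4 ^ n < c (b n)" and "c (b n) < c (b (Suc n))" for n
    by blast
  then have "strict_mono (c \<circ> b)"
    by (simp add: strict_mono_Suc_iff)
  then have inj: "inj b"
    using inj_on_imageI2 strict_mono_imp_inj_on by blast
  define x :: "_ \<Rightarrow> complex" where "x \<gamma> = (if \<gamma> \<in> range b then (1/2) ^ (inv b \<gamma>) else 0)" for \<gamma>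
  have x_b: "(cmod (x (b n)))\<^sup>2 = (1/4) ^ n" for n
  proof -
    have "(cmod (x (b n)))\<^sup>2 = ((1/2) ^ n)\<^sup>2"
      using inj by (simp add: x_def norm_power norm_divide)
    also have "\<dots> = (1/4) ^ n"
      by (simp add: power2_eq_square flip: power_mult_distrib)
    finally show ?thesis .
  qed
  have "(\<lambda>n. (1/4 :: real) ^ n) summable_on UNIV"
    by (rule norm_summable_imp_summable_on) (simp add: summable_geometric)
  then have "((\<lambda>\<gamma>. (cmod (x \<gamma>))\<^sup>2) \<circ> b) summable_on UNIV"
    by (simp add: comp_def x_b)
  then have "(\<lambda>\<gamma>. (cmod (x \<gamma>))\<^sup>2) summable_on range b"
    by (simp add: summable_on_reindex[OF inj])
  then have "x \<in> ell2"
    unfolding ell2_def mem_Collect_eq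
    by (rule summable_on_cong_neutral[THEN iffD1, rotated -1]) (auto simp: x_def)
  then have "wgs \<phi> u x \<in> ell2"
    using assms by blast
  then have "(\<lambda>\<alpha>. (cmod (u \<alpha>))\<^sup>2 * (cmod (x (\<phi> \<alpha>)))\<^sup>2) summable_on UNIV"
    by (simp add: ell2_def wgs_def norm_mult power_mult_distrib)
  \<comment> \<open>Group the square sum of \<open>wgs \<phi> u x\<close> by fibres:
    \<open>x (\<phi> \<alpha>)\<close> is constant on each, so the fibre over \<open>\<beta>\<close>
    contributes \<open>c \<beta>\<close> times the squared modulus of
    \<open>x \<beta>\<close>.\<close>
  from infsum_fibres(1)[OF this, of \<phi>]
  have "(\<lambda>\<beta>. \<Sum>\<^sub>\<infinity>\<alpha>\<in>\<phi> -` {\<beta>}. (cmod (u \<alpha>))\<^sup>2 * (cmod (x (\<phi> \<alpha>)))\<^sup>2) summable_on UNIV" .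
  moreover have "(\<Sum>\<^sub>\<infinity>\<alpha>\<in>\<phi> -` {\<beta>}. (cmod (u \<alpha>))\<^sup>2 * (cmod (x (\<phi> \<alpha>)))\<^sup>2) = c \<beta> * (cmod (x \<beta>))\<^sup>2" for \<beta>
  proof -
    have "(\<Sum>\<^sub>\<infinity>\<alpha>\<in>\<phi> -` {\<beta>}. (cmod (u \<alpha>))\<^sup>2 * (cmod (x (\<phi> \<alpha>)))\<^sup>2)
        = (\<Sum>\<^sub>\<infinity>\<alpha>\<in>\<phi> -` {\<beta>}. (cmod (u \<alpha>))\<^sup>2 * (cmod (x \<beta>))\<^sup>2)"
      by (rule infsum_cong) auto
    then show ?thesis
      using wgs_fibre_summable[OF assms] by (simp add: c_def infsum_cmult_left)
  qed
  ultimately have "(\<lambda>\<beta>. c \<beta> * (cmod (x \<beta>))\<^sup>2) summable_on range b"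
    by (auto intro: summable_on_subset_banach)
  then have "(\<lambda>n. c (b n) * (1/4) ^ n) summable_on UNIV"
    by (simp add: summable_on_reindex[OF inj] comp_def x_b)
  \<comment> \<open>The growth of \<open>c (b n)\<close> outweighs the decay of \<open>x\<close>, so
    a summable family would dominate the constant 1.\<close>
  moreover have "1 \<le> c (b n) * (1/4) ^ n" for n
    using b[of n] by (simp add: power_one_over field_simps)
  ultimately have "(\<lambda>n::nat. 1 :: real) summable_on UNIV"
    by (rule summable_on_comparison_test) simp
  then have "(\<lambda>n::nat. 1 :: real) \<longlonglongrightarrow> 0"
    by (intro summable_LIMSEQ_zero summable_on_imp_summable)
  then show False
    by (simp add: LIMSEQ_const_iff)
qed

section \<open>Adjoints of weighted generalized shifts\<close>

text \<open>By injectivity on \<open>D\<close>, each coordinate of the argument is used at most once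
  with a nonzero weight, so the square sum grows at most by the factor \<open>M\<close>.\<close>

lemma wgs_maps_ell2:
  assumes "inj_on \<phi> D" and "\<And>\<beta>. \<beta> \<notin> D \<Longrightarrow> v \<beta> = 0" and "\<And>\<beta>. (cmod (v \<beta>))\<^sup>2 \<le> M"
  shows "wgs \<phi> v ` ell2 \<subseteq> ell2"
proof (intro image_subsetI)
  fix y :: "'a \<Rightarrow> complex" assume "y \<in> ell2"
  then have "(\<lambda>\<alpha>. (cmod (y \<alpha>))\<^sup>2) summable_on \<phi> ` D"
    unfolding ell2_def by (auto intro: summable_on_subset_banach)
  then have "(\<lambda>\<beta>. M * (cmod (y (\<phi> \<beta>)))\<^sup>2) summable_on D"
    by (intro summable_on_cmult_right) (simp add: summable_on_reindex[OF assms(1)] comp_def)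
  then have "(\<lambda>\<beta>. (cmod (wgs \<phi> v y \<beta>))\<^sup>2) summable_on D"
    by (rule summable_on_comparison_test)
      (auto simp: wgs_def norm_mult power_mult_distrib assms(3) mult_right_mono)
  then show "wgs \<phi> v y \<in> ell2"
    unfolding ell2_def mem_Collect_eq
    by (rule summable_on_cong_neutral[THEN iffD1, rotated -1]) (auto simp: wgs_def assms(2))
qed

text \<open>Summing the inner product fibre by fibre lets \<open>x \<beta>\<close> be pulled out,
  which leaves the conjugate of coordinate \<open>\<beta>\<close> of \<open>T' y\<close>.\<close>

lemma wgs_adjoint:
  assumes T: "wgs \<phi> u ` ell2 \<subseteq> ell2" and T': "T' \<in> ell2 \<rightarrow>\<^sub>E ell2"
    and eq: "\<And>y \<beta>. y \<in> ell2 \<Longrightarrow> T' y \<beta> = (\<Sum>\<^sub>\<infinity>\<alpha>\<in>\<phi> -` {\<beta>}. cnj (u \<alpha>) * y \<alpha>)"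
  shows "is_ell2_adjoint (restrict (wgs \<phi> u) ell2) T'"
  unfolding is_ell2_adjoint_def
proof (intro conjI ballI T')
  fix x y :: "'a \<Rightarrow> complex" assume x: "x \<in> ell2" and y: "y \<in> ell2"
  have "(\<lambda>\<alpha>. wgs \<phi> u x \<alpha> * cnj (y \<alpha>)) summable_on UNIV"
    using T x y by (intro ell2_inner_summable) auto
  then have "ell2_inner (wgs \<phi> u x) y = (\<Sum>\<^sub>\<infinity>\<beta>. \<Sum>\<^sub>\<infinity>\<alpha>\<in>\<phi> -` {\<beta>}. wgs \<phi> u x \<alpha> * cnj (y \<alpha>))"
    unfolding ell2_inner_def by (rule infsum_fibres)
  also have "\<dots> = (\<Sum>\<^sub>\<infinity>\<beta>. x \<beta> * cnj (T' y \<beta>))"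
  proof (rule infsum_cong)
    fix \<beta>
    have "(\<Sum>\<^sub>\<infinity>\<alpha>\<in>\<phi> -` {\<beta>}. wgs \<phi> u x \<alpha> * cnj (y \<alpha>))
        = (\<Sum>\<^sub>\<infinity>\<alpha>\<in>\<phi> -` {\<beta>}. x \<beta> * cnj (cnj (u \<alpha>) * y \<alpha>))"
      by (rule infsum_cong) (auto simp: wgs_def)
    also have "\<dots> = x \<beta> * (\<Sum>\<^sub>\<infinity>\<alpha>\<in>\<phi> -` {\<beta>}. cnj (cnj (u \<alpha>) * y \<alpha>))"
      by (rule infsum_cmult_right')
    also have "\<dots> = x \<beta> * cnj (T' y \<beta>)"
      by (simp only: infsum_cnj eq[OF y])
    finally show "(\<Sum>\<^sub>\<infinity>\<alpha>\<in>\<phi> -` {\<beta>}. wgs \<phi> u x \<alpha> * cnj (y \<alpha>)) = x \<beta> * cnj (T' y \<beta>)" .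
  qed
  finally show "ell2_inner (restrict (wgs \<phi> u) ell2 x) y = ell2_inner x (T' y)"
    using x by (simp add: ell2_inner_def)
qed

text \<open>Choosing the \<open>k\<close>-th support point in each fibre gives a right inverse of
  \<open>\<phi>\<close> where such a point exists. It is therefore injective there, and each choice
  yields a shift on \<open>ell2\<close>.\<close>

lemma wgs_adjoint_in_semigroup:
  fixes \<phi> :: "'a \<Rightarrow> 'a" and u :: "'a \<Rightarrow> complex"
  assumes T: "wgs \<phi> u ` ell2 \<subseteq> ell2"
    and B: "0 \<in> B" "\<And>\<alpha>. cnj (u \<alpha>) \<in> B"
    and fin: "\<And>\<beta>. finite {\<alpha>. \<phi> \<alpha> = \<beta> \<and> u \<alpha> \<noteq> 0}"
    and card: "\<And>\<beta>. card {\<alpha>. \<phi> \<alpha> = \<beta> \<and> u \<alpha> \<noteq> 0} \<le> N"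
  shows "\<exists>T'\<in>additive_semigroup (wgs_operators B).
           is_ell2_adjoint (restrict (wgs \<phi> u) ell2) T'"
proof -
  define F where "F \<beta> = {\<alpha>. \<phi> \<alpha> = \<beta> \<and> u \<alpha> \<noteq> 0}" for \<beta>
  have "\<forall>\<beta>. \<exists>h. bij_betw h {..<card (F \<beta>)} (F \<beta>)"
    using ex_bij_betw_nat_finite[OF fin] by (simp add: F_def atLeast0LessThan)
  then obtain e where e: "bij_betw (e \<beta>) {..<card (F \<beta>)} (F \<beta>)" for \<beta>
    by metis
  \<comment> \<open>Where the fibre has at most \<open>k\<close> support points,
    \<open>e \<beta> k\<close> is arbitrary; the weight 0, available by \<open>0 \<in> B\<close>,
    neutralizes it.\<close>
  define v where "v k \<beta> = (if k < card (F \<beta>) then cnj (u (e \<beta> k)) else 0)" for k \<beta>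
  \<comment> \<open>Supports have at most \<open>N\<close> points, so the term \<open>k = N\<close>
    is zero; it keeps the sum nonempty when \<open>N = 0\<close>.\<close>
  define T' where "T' = restrict (\<lambda>y \<beta>. \<Sum>k\<le>N. wgs (\<lambda>\<beta>. e \<beta> k) (v k) y \<beta>) ell2"
  obtain M where M: "(\<Sum>\<^sub>\<infinity>\<alpha>\<in>\<phi> -` {\<beta>}. (cmod (u \<alpha>))\<^sup>2) \<le> M" for \<beta>
    using wgs_fibre_bounded[OF T] by blast
  have u_le: "(cmod (u \<alpha>))\<^sup>2 \<le> M" for \<alpha>
  proof -
    have "(\<Sum>\<gamma>\<in>{\<alpha>}. (cmod (u \<gamma>))\<^sup>2) \<le> (\<Sum>\<^sub>\<infinity>\<gamma>\<in>\<phi> -` {\<phi> \<alpha>}. (cmod (u \<gamma>))\<^sup>2)"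
      by (rule finite_sum_le_infsum[OF wgs_fibre_summable[OF T]]) auto
    with M[of "\<phi> \<alpha>"] show ?thesis
      by simp
  qed
  have "0 \<le> M"
    using u_le[of undefined] zero_le_power2 order_trans by blast
  have \<phi>_e: "\<phi> (e \<beta> k) = \<beta>" if "k < card (F \<beta>)" for k \<beta>
    using bij_betwE[OF e[of \<beta>]] that by (auto simp: F_def)
  have "restrict (wgs (\<lambda>\<beta>. e \<beta> k) (v k)) ell2 \<in> wgs_operators B" for k
  proof -
    have "wgs (\<lambda>\<beta>. e \<beta> k) (v k) ` ell2 \<subseteq> ell2"
    proof (rule wgs_maps_ell2)
      show "inj_on (\<lambda>\<beta>. e \<beta> k) {\<beta>. k < card (F \<beta>)}"
        by (rule inj_on_inverseI[where g = \<phi>]) (simp add: \<phi>_e)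
      show "(cmod (v k \<beta>))\<^sup>2 \<le> M" for \<beta>
        using u_le \<open>0 \<le> M\<close> by (simp add: v_def)
    qed (simp add: v_def)
    moreover have "\<forall>\<beta>. v k \<beta> \<in> B"
      using B by (simp add: v_def)
    ultimately show ?thesis
      unfolding wgs_operators_def by blast
  qed
  then have T': "T' \<in> additive_semigroup (wgs_operators B)"
    unfolding T'_def by (rule additive_semigroup_sum)
  moreover have "is_ell2_adjoint (restrict (wgs \<phi> u) ell2) T'"
  proof (rule wgs_adjoint[OF T additive_semigroup_maps_ell2[OF T']])
    fix y :: "'a \<Rightarrow> complex" and \<beta> assume "y \<in> ell2"
    then have "T' y \<beta> = (\<Sum>k\<le>N. v k \<beta> * y (e \<beta> k))"
      by (simp add: T'_def wgs_def)
    also have "\<dots> = (\<Sum>k<card (F \<beta>). cnj (u (e \<beta> k)) * y (e \<beta> k))"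
      using card[of \<beta>] by (intro sum.mono_neutral_cong_right) (auto simp: v_def F_def)
    also have "\<dots> = (\<Sum>\<alpha>\<in>F \<beta>. cnj (u \<alpha>) * y \<alpha>)"
      by (rule sum.reindex_bij_betw[OF e])
    also have "\<dots> = (\<Sum>\<^sub>\<infinity>\<alpha>\<in>F \<beta>. cnj (u \<alpha>) * y \<alpha>)"
      using fin by (simp add: F_def)
    also have "\<dots> = (\<Sum>\<^sub>\<infinity>\<alpha>\<in>\<phi> -` {\<beta>}. cnj (u \<alpha>) * y \<alpha>)"
      by (rule infsum_cong_neutral) (auto simp: F_def)
    finally show "T' y \<beta> = (\<Sum>\<^sub>\<infinity>\<alpha>\<in>\<phi> -` {\<beta>}. cnj (u \<alpha>) * y \<alpha>)" .
  qed
  ultimately show ?thesis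
    by blast
qed

section \<open>Sufficiency: uniformly finite fibre supports\<close>

text \<open>Each support point adds at least \<open>\<epsilon>\<^sup>2\<close> to a fibre sum that
  is at most \<open>M\<close>, which leaves room for at most \<open>M / \<epsilon>\<^sup>2\<close>
  points.\<close>

lemma wgs_fibre_support_card:
  assumes T: "wgs \<phi> u ` ell2 \<subseteq> ell2" and "0 < \<epsilon>"
    and far: "\<And>\<alpha>. u \<alpha> \<noteq> 0 \<Longrightarrow> \<epsilon> \<le> cmod (u \<alpha>)"
  obtains N where "\<And>\<beta>. finite {\<alpha>. \<phi> \<alpha> = \<beta> \<and> u \<alpha> \<noteq> 0}"
    "\<And>\<beta>. card {\<alpha>. \<phi> \<alpha> = \<beta> \<and> u \<alpha> \<noteq> 0} \<le> N"
proof -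
  obtain M where M: "(\<Sum>\<^sub>\<infinity>\<alpha>\<in>\<phi> -` {\<beta>}. (cmod (u \<alpha>))\<^sup>2) \<le> M" for \<beta>
    using wgs_fibre_bounded[OF T] by blast
  \<comment> \<open>Bounding all finite subsets \<open>G\<close> of the support gives its finiteness
    together with the cardinality bound.\<close>
  have "card G \<le> nat \<lfloor>M / \<epsilon>\<^sup>2\<rfloor>"
    if G: "G \<subseteq> {\<alpha>. \<phi> \<alpha> = \<beta> \<and> u \<alpha> \<noteq> 0}" "finite G" for G \<beta>
  proof -
    have "real (card G) * \<epsilon>\<^sup>2 \<le> (\<Sum>\<alpha>\<in>G. (cmod (u \<alpha>))\<^sup>2)"
    proof (rule sum_bounded_below)
      fix \<alpha> assume "\<alpha> \<in> G"
      then have "\<epsilon> \<le> cmod (u \<alpha>)"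
        using G far by auto
      then show "\<epsilon>\<^sup>2 \<le> (cmod (u \<alpha>))\<^sup>2"
        using \<open>0 < \<epsilon>\<close> by (simp add: power_mono)
    qed
    also have "\<dots> \<le> (\<Sum>\<^sub>\<infinity>\<alpha>\<in>\<phi> -` {\<beta>}. (cmod (u \<alpha>))\<^sup>2)"
      using G by (intro finite_sum_le_infsum[OF wgs_fibre_summable[OF T]]) auto
    also have "\<dots> \<le> M"
      by (rule M)
    finally show ?thesis
      using \<open>0 < \<epsilon>\<close> by (simp add: le_nat_floor field_simps)
  qed
  then have "finite {\<alpha>. \<phi> \<alpha> = \<beta> \<and> u \<alpha> \<noteq> 0} \<and> card {\<alpha>. \<phi> \<alpha> = \<beta> \<and> u \<alpha> \<noteq> 0} \<le> nat \<lfloor>M / \<epsilon>\<^sup>2\<rfloor>" for \<beta>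
    by (intro finite_if_finite_subsets_card_bdd) blast
  then show thesis
    using that by blast
qed

lemma adjoint_invariant_if:
  fixes A :: "complex set"
  assumes "conjugate_invariant A" and "finite (UNIV :: 'a set) \<or> \<not> 0 islimpt A"
  shows "adjoint_invariant (additive_semigroup (wgs_operators (A \<union> {0}) :: 'a ell2_op set))"
proof -
  let ?S = "additive_semigroup (wgs_operators (A \<union> {0}) :: 'a ell2_op set)"
  \<comment> \<open>The relation \<open>is_ell2_adjoint\<close> is carried through the induction
    because it is compatible with sums; uniqueness turns it into \<open>ell2_adjoint\<close>
    afterwards.\<close>
  have "\<exists>T'\<in>?S. is_ell2_adjoint T T'" if "T \<in> ?S" for T
    using that
  proof induction
    case (generator T)
    then obtain \<phi> u where T_eq: "T = restrict (wgs \<phi> u) ell2"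
      and u: "\<And>\<alpha>. u \<alpha> \<in> A \<union> {0}" and T: "wgs \<phi> u ` ell2 \<subseteq> ell2"
      unfolding wgs_operators_def by blast
    obtain N where fin: "\<And>\<beta>. finite {\<alpha>. \<phi> \<alpha> = \<beta> \<and> u \<alpha> \<noteq> 0}"
      and card: "\<And>\<beta>. card {\<alpha>. \<phi> \<alpha> = \<beta> \<and> u \<alpha> \<noteq> 0} \<le> N"
    proof (cases "finite (UNIV :: 'a set)")
      case True
      show thesis
        by (rule that[OF finite_subset[OF subset_UNIV True] card_mono[OF True subset_UNIV]])
    next
      case False
      \<comment> \<open>\<open>\<epsilon>\<close> is the radius of a punctured disc around 0 that
        misses \<open>A\<close>.\<close>
      then obtain \<epsilon> where "0 < \<epsilon>" and \<epsilon>: "\<And>a. a \<in> A \<Longrightarrow> a \<noteq> 0 \<Longrightarrow> \<epsilon> \<le> cmod a"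
        using assms(2) by (auto simp: islimpt_approachable not_less)
      have far: "\<epsilon> \<le> cmod (u \<alpha>)" if "u \<alpha> \<noteq> 0" for \<alpha>
        using u[of \<alpha>] that by (intro \<epsilon>) simp_all
      show thesis
        by (rule wgs_fibre_support_card[OF T \<open>0 < \<epsilon>\<close> far that])
    qed
    have "cnj (u \<alpha>) \<in> A \<union> {0}" for \<alpha>
      using u[of \<alpha>] assms(1) by (auto simp: conjugate_invariant_def)
    then show ?case
      unfolding T_eq by (intro wgs_adjoint_in_semigroup[OF T _ _ fin card]) auto
  next
    case (add S T)
    then show ?case
      using is_ell2_adjoint_add additive_semigroup_maps_ell2 additive_semigroup.add by meson
  qed
  then show ?thesis
    unfolding adjoint_invariant_def using ell2_adjoint_eqI by metis
qed

section \<open>Necessity: an adjoint with an infinite row\<close>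

text \<open>Nonzero points of \<open>A\<close> that tend to 0 geometrically are placed along an
  injective sequence of indices, with 0 elsewhere.\<close>

lemma ell2_infinite_support:
  assumes "infinite (UNIV :: 'a set)" and "0 islimpt A"
  obtains u :: "'a \<Rightarrow> complex"
    where "u \<in> ell2" "\<forall>\<alpha>. u \<alpha> \<in> A \<union> {0}" "infinite {\<alpha>. u \<alpha> \<noteq> 0}"
proof -
  obtain f :: "nat \<Rightarrow> 'a" where f: "inj f"
    using assms(1) infinite_countable_subset by blast
  have "\<exists>a\<in>A. a \<noteq> 0 \<and> cmod a < (1/2) ^ n" for n :: nat
    using assms(2) zero_less_power[of "1/2 :: real" n]
    unfolding islimpt_approachable dist_0_norm dist_commute[of _ 0] by simp
  then obtain a where a: "a n \<in> A" "a n \<noteq> 0" "cmod (a n) < (1/2) ^ n" for n :: nat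
    by metis
  define u where "u \<alpha> = (if \<alpha> \<in> range f then a (inv f \<alpha>) else 0)" for \<alpha>
  have u_f: "u (f n) = a n" for n
    using f by (simp add: u_def)
  have "(\<lambda>n. (1/2 :: real) ^ n) summable_on UNIV"
    by (rule norm_summable_imp_summable_on) (simp add: summable_geometric)
  moreover have "(cmod (a n))\<^sup>2 \<le> (1/2) ^ n" for n
  proof -
    have "(cmod (a n))\<^sup>2 \<le> cmod (a n)"
      using a(3)[of n] power_le_one[of "1/2 :: real" n]
      by (simp add: power2_eq_square mult_left_le)
    with a(3)[of n] show ?thesis
      by simp
  qed
  ultimately have "(\<lambda>n. (cmod (a n))\<^sup>2) summable_on UNIV"
    by (rule summable_on_comparison_test) auto
  then have "(\<lambda>\<alpha>. (cmod (u \<alpha>))\<^sup>2) summable_on range f"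
    by (simp add: summable_on_reindex[OF f] comp_def u_f)
  then have "u \<in> ell2"
    unfolding ell2_def mem_Collect_eq
    by (rule summable_on_cong_neutral[THEN iffD1, rotated -1]) (auto simp: u_def)
  moreover have "\<forall>\<alpha>. u \<alpha> \<in> A \<union> {0}"
    using a by (simp add: u_def)
  moreover have "infinite {\<alpha>. u \<alpha> \<noteq> 0}"
  proof (rule infinite_super)
    show "range f \<subseteq> {\<alpha>. u \<alpha> \<noteq> 0}"
      using a u_f by auto
    show "infinite (range f)"
      using f by (rule range_inj_infinite)
  qed
  ultimately show thesis
    using that by blast
qed

lemma not_adjoint_invariant:
  fixes A :: "complex set"
  assumes "infinite (UNIV :: 'a set)" and "0 islimpt A"
  shows "\<not> adjoint_invariant (additive_semigroup (wgs_operators (A \<union> {0}) :: 'a ell2_op set))"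
proof
  let ?S = "additive_semigroup (wgs_operators (A \<union> {0}) :: 'a ell2_op set)"
  assume inv: "adjoint_invariant ?S"
  obtain u :: "'a \<Rightarrow> complex"
    where u: "u \<in> ell2" "\<forall>\<alpha>. u \<alpha> \<in> A \<union> {0}" and inf: "infinite {\<alpha>. u \<alpha> \<noteq> 0}"
    by (rule ell2_infinite_support[OF assms])
  define \<beta> :: 'a where "\<beta> = undefined"
  \<comment> \<open>The shift below maps \<open>x\<close> to \<open>x \<beta>\<close> times
    \<open>u\<close>, a rank one operator at most; its adjoint puts the inner product of
    \<open>y\<close> with \<open>u\<close> into coordinate \<open>\<beta>\<close>.\<close>
  define T' where "T' = restrict (\<lambda>y \<gamma>. if \<gamma> = \<beta> then (\<Sum>\<^sub>\<infinity>\<alpha>. cnj (u \<alpha>) * y \<alpha>) else 0) ell2"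
  have T: "wgs (\<lambda>_. \<beta>) u ` ell2 \<subseteq> ell2"
    using u(1) by (auto simp: ell2_def wgs_def norm_mult power_mult_distrib
        intro!: summable_on_cmult_left)
  have T': "T' \<in> ell2 \<rightarrow>\<^sub>E ell2"
    by (simp add: T'_def ell2_single)
  have "is_ell2_adjoint (restrict (wgs (\<lambda>_. \<beta>) u) ell2) T'"
  proof (rule wgs_adjoint[OF T T'])
    fix y :: "'a \<Rightarrow> complex" and \<gamma> assume "y \<in> ell2"
    then show "T' y \<gamma> = (\<Sum>\<^sub>\<infinity>\<alpha>\<in>(\<lambda>_. \<beta>) -` {\<gamma>}. cnj (u \<alpha>) * y \<alpha>)"
      by (auto simp: T'_def vimage_def)
  qed
  then have "ell2_adjoint (restrict (wgs (\<lambda>_. \<beta>) u) ell2) = T'"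
    by (rule ell2_adjoint_eqI)
  moreover have "restrict (wgs (\<lambda>_. \<beta>) u) ell2 \<in> ?S"
    using T u(2) by (intro additive_semigroup.generator) (auto simp: wgs_operators_def)
  ultimately have "T' \<in> ?S"
    using inv unfolding adjoint_invariant_def by metis
  from additive_semigroup_finite_row[OF this, of \<beta>] obtain F
    where "finite F" and F: "\<And>x. x \<in> ell2 \<Longrightarrow> (\<And>\<alpha>. \<alpha> \<in> F \<Longrightarrow> x \<alpha> = 0) \<Longrightarrow> T' x \<beta> = 0"
    by blast
  \<comment> \<open>The unit vector at a support point outside \<open>F\<close> vanishes on
    \<open>F\<close>, yet \<open>T'\<close> detects it through
    \<open>cnj (u \<alpha>)\<close>.\<close>
  with inf obtain \<alpha> where \<alpha>: "u \<alpha> \<noteq> 0" "\<alpha> \<notin> F"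
    by (metis (mono_tags, lifting) finite_subset mem_Collect_eq subsetI)
  let ?e = "\<lambda>\<gamma>. if \<gamma> = \<alpha> then 1 else 0 :: complex"
  have "T' ?e \<beta> = (\<Sum>\<^sub>\<infinity>\<gamma>. cnj (u \<gamma>) * ?e \<gamma>)"
    by (simp add: T'_def ell2_single)
  also have "\<dots> = (\<Sum>\<^sub>\<infinity>\<gamma>\<in>{\<alpha>}. cnj (u \<gamma>) * ?e \<gamma>)"
    by (rule infsum_cong_neutral) auto
  finally have "T' ?e \<beta> = cnj (u \<alpha>)"
    by simp
  moreover have "T' ?e \<beta> = 0"
    using \<alpha> by (intro F ell2_single) auto
  ultimately show False
    using \<alpha> by simp
qed

theorem theorem3p1:
  fixes A :: "complex set"
  assumes "A \<noteq> {}" and "conjugate_invariant A"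
  shows "adjoint_invariant (additive_semigroup (wgs_operators (A \<union> {0}) :: 'a ell2_op set)) \<longleftrightarrow>
         (finite (UNIV :: 'a set) \<or> \<not> (0 islimpt A))"
  using adjoint_invariant_if[OF assms(2)] not_adjoint_invariant by blast

end
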